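(* For every complex number $q$ with $|q|<1$, $$\sum_{n\geq 0} F_2(n) q^n=\frac{q(1-q^3)}{(1-q)(1-q^2)}\,\frac{(q^2;q^2)_\infty^2}{(q;q^2)_\infty^2}-\frac{q(1+q^2)}{(1-q)^2},$$ where $F_2(n)$ are the power series coefficients defined by $$\sum_{n\geq 0} F_2(n) q^n=\sum_{k,n\geq 0} \frac{(q^{2n+2};q^2)_k}{(q^{2n+5};q^2)_k}\,q^{2k+n+2}.$$
   Context: Notation: $q$ is a complex number with $|q|<1$; $(a;q)_0=1$, $(a;q)_n=\prod_{j=0}^{n-1}(1-aq^j)$, $(a;q)_\infty=\prod_{j=0}^\infty(1-aq^j)$ (and the same with $q$ replaced by $q^2$). The double sum runs over all nonnegative integers $k,n$. The integers $F_2(N)$, $N\ge 0$, are the coefficients of the power series in $q$ given by this double sum. *)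

theory Defs
  imports "HOL-Analysis.Analysis"
begin

definition qpoch :: "complex \<Rightarrow> complex \<Rightarrow> nat \<Rightarrow> complex"
  where "qpoch a q n = (\<Prod>j<n. 1 - a * q ^ j)"

definition qpoch_inf :: "complex \<Rightarrow> complex \<Rightarrow> complex"
  where "qpoch_inf a q = (\<Prod>j. 1 - a * q ^ j)"

definition F2_term :: "complex \<Rightarrow> nat \<times> nat \<Rightarrow> complex"
  where "F2_term q = (\<lambda>(k, n).
    qpoch (q ^ (2 * n + 2)) (q ^ 2) k / qpoch (q ^ (2 * n + 5)) (q ^ 2) k * q ^ (2 * k + n + 2))"

(* The integer coefficients of the power series expansion of the double sum on the unit disc.
   A power series is determined by its sum on the disc, so at most one F satisfies this;
   that one exists is not built into the definition. *)
definition F2 :: "nat \<Rightarrow> int"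
  where "F2 = (THE F. \<forall>q::complex. norm q < 1 \<longrightarrow>
    (\<lambda>N. of_int (F N) * q ^ N) sums (\<Sum>\<^sub>\<infinity>p\<in>UNIV. F2_term q p))"

end

theory Submission
  imports Defs "HOL-Complex_Analysis.Complex_Analysis"
begin

text \<open>
  Write \<open>Q = q\<^sup>2\<close> and \<open>P = (Q;Q)\<^sub>\<infinity> / (q;Q)\<^sub>\<infinity>\<close>.  The engine is the q-binomial theorem
  (\<open>q_binomial\<close>), which expands a quotient of infinite products \<open>(az)\<^sub>\<infinity>/(z)\<^sub>\<infinity>\<close> as a power
  series in \<open>z\<close>.  When \<open>z\<close> is replaced by \<open>w q\<^sup>n\<close> inside a sum over \<open>n\<close>, this gives a double series
  with the symmetric kernel \<open>q\<^sup>n\<^sup>m\<close>, in which the summations can be exchanged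
  (\<open>q_kernel_swap\<close>); Heine's transformation
  (\<open>heine_symmetric\<close>) is the instance in which the other sum is again a q-binomial series.

  The quotient \<open>(q\<^sup>2\<^sup>n\<^sup>+\<^sup>2;Q)\<^sub>k / (q\<^sup>2\<^sup>n\<^sup>+\<^sup>5;Q)\<^sub>k\<close> depends on \<open>k\<close> only through \<open>n + k\<close>,
  up to a factor in \<open>n\<close> alone.  One Heine transformation deals with the sum over \<open>k\<close> and one more
  exchange with the sum over \<open>n\<close>.  This leaves a multiple of the single sum
  \<open>V = \<Sum>\<^sub>m (q;Q)\<^sub>m (q\<^sup>3;Q)\<^sub>m / ((Q;Q)\<^sub>m\<^sub>+\<^sub>1 (Q;Q)\<^sub>m\<^sub>+\<^sub>2) Q\<^sup>m\<close> (\<open>F2_double_sum_eq_single_sum\<close>).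

  Up to a constant, the terms of \<open>V\<close> are those with index at least 1 of the basic hypergeometric series
  \<open>\<^sub>2\<phi>\<^sub>1(1/q, q; q\<^sup>4; Q, Q)\<close>, and Heine's transformation turns this series into a
  difference of two geometric series (\<open>single_sum_by_heine\<close>).  Hence \<open>V\<close> is, up to that constant,
  the transformed value minus the missing term of index 0: the missing term produces the part of the closed form with
  \<open>P\<^sup>2\<close>, the geometric series produce the rational part.

  It remains to see that the coefficients \<open>F2\<close> exist as integers.  This is read off from the closed form:
  the functions that are holomorphic on the unit disc and have integer Taylor coefficients at 0 are closed under
  ring operations, under inverses of functions with value 1 at 0 and without zeros, and under locally
  uniform limits, since \<open>\<int>\<close> is closed in \<open>\<complex>\<close>; infinite products are such limits.
\<close>

section \<open>Finite and infinite q-Pochhammer symbols\<close>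

lemma qpoch_0 [simp]: "qpoch a q 0 = 1"
  by (simp add: qpoch_def)

lemma qpoch_Suc: "qpoch a q (Suc n) = qpoch a q n * (1 - a * q ^ n)"
  by (simp add: qpoch_def)

lemma qpoch_add: "qpoch a q (m + n) = qpoch a q m * qpoch (a * q ^ m) q n"
  by (induction n) (simp_all add: qpoch_Suc power_add mult.assoc)

lemma qpoch_Suc': "qpoch a q (Suc n) = (1 - a) * qpoch (a * q) q n"
  using qpoch_add [of a q 1 n] by (simp add: qpoch_Suc)

lemma qpoch_nonzero: "(\<And>n. a * q ^ n \<noteq> 1) \<Longrightarrow> qpoch a q n \<noteq> 0"
  unfolding qpoch_def by simp

lemma norm_mult_power_less_one:
  fixes q a :: complex
  assumes "norm q < 1" "norm a < 1"
  shows "norm (a * q ^ n) < 1"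
proof -
  have "norm a * norm q ^ n \<le> norm a * 1"
    using assms by (intro mult_left_mono power_le_one) auto
  thus ?thesis using assms by (simp add: norm_mult norm_power)
qed

lemma mult_power_neq_one:
  fixes q a :: complex
  assumes "norm q < 1" "norm a < 1"
  shows "a * q ^ n \<noteq> 1"
  using norm_mult_power_less_one[OF assms, of n] by auto

lemma norm_power_less_one:
  fixes q :: complex
  assumes "norm q < 1" "0 < n"
  shows "norm (q ^ n) < 1"
  using assms by (simp add: norm_power power_Suc_less_one power_less_one_iff)

lemma qpoch_convergent_prod:
  fixes q a :: complex
  assumes "norm q < 1"
  shows "convergent_prod (\<lambda>j. 1 - a * q ^ j)"
proof -
  have "summable (\<lambda>j. norm (1 - a * q ^ j - 1))"
    using assms by (simp add: norm_mult norm_power summable_geometric summable_mult)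
  thus ?thesis
    by (intro abs_convergent_prod_imp_convergent_prod summable_imp_abs_convergent_prod)
qed

lemma qpoch_tendsto:
  assumes "norm q < 1"
  shows "qpoch a q \<longlonglongrightarrow> qpoch_inf a q"
proof -
  have "(\<lambda>n. \<Prod>j\<le>n. 1 - a * q ^ j) \<longlonglongrightarrow> qpoch_inf a q"
    unfolding qpoch_inf_def using qpoch_convergent_prod[OF assms] by (rule convergent_prod_LIMSEQ)
  hence "(\<lambda>n. \<Prod>j<n. 1 - a * q ^ j) \<longlonglongrightarrow> qpoch_inf a q"
    by (simp add: LIMSEQ_lessThan_iff_atMost)
  thus ?thesis by (simp add: qpoch_def [abs_def])
qed

lemma qpoch_inf_nonzero:
  assumes "norm q < 1" "\<And>n. a * q ^ n \<noteq> 1"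
  shows "qpoch_inf a q \<noteq> 0"
  unfolding qpoch_inf_def using assms qpoch_convergent_prod
  by (intro prodinf_nonzero) auto

lemma qpoch_inf_split:
  assumes "norm q < 1"
  shows "qpoch_inf a q = qpoch a q n * qpoch_inf (a * q ^ n) q"
proof (rule LIMSEQ_unique)
  show "(\<lambda>m. qpoch a q (n + m)) \<longlonglongrightarrow> qpoch_inf a q"
    using LIMSEQ_ignore_initial_segment[OF qpoch_tendsto[OF assms], of a n] by (simp add: add.commute)
  show "(\<lambda>m. qpoch a q (n + m)) \<longlonglongrightarrow> qpoch a q n * qpoch_inf (a * q ^ n) q"
    unfolding qpoch_add by (intro tendsto_intros qpoch_tendsto assms)
qed

lemma Bseq_qpoch_ratio:
  assumes "norm q < 1" "\<And>n. b * q ^ n \<noteq> 1"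
  shows "Bseq (\<lambda>n. qpoch a q n / qpoch b q n)"
proof -
  have "(\<lambda>n. qpoch a q n / qpoch b q n) \<longlonglongrightarrow> qpoch_inf a q / qpoch_inf b q"
    using assms by (intro tendsto_intros qpoch_tendsto qpoch_inf_nonzero)
  thus ?thesis by (intro convergent_imp_Bseq convergentI)
qed

section \<open>The q-binomial theorem and Heine's transformation\<close>

lemma summable_norm_Bseq_power:
  fixes \<alpha> :: "nat \<Rightarrow> complex"
  assumes "Bseq \<alpha>" "norm z < 1"
  shows "summable (\<lambda>n. norm (\<alpha> n * z ^ n))"
proof -
  obtain K where "\<And>n. norm (\<alpha> n) \<le> K" using assms(1) by (auto simp: Bseq_def)
  hence "norm (norm (\<alpha> n * z ^ n)) \<le> K * norm z ^ n" for n
    by (simp add: norm_mult norm_power mult_right_mono)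
  moreover have "summable (\<lambda>n. K * norm z ^ n)"
    using assms(2) by (intro summable_mult summable_geometric) auto
  ultimately show ?thesis by (rule summable_comparison_test'[rotated])
qed

text \<open>
  The series \<open>f\<close> satisfies \<open>(1 - w) f(w) = (1 - a w) f(w q)\<close>, because consecutive coefficients
  have ratio \<open>(1 - a q\<^sup>n) / (1 - q\<^sup>n\<^sup>+\<^sup>1)\<close>.  Iterating this produces the finite
  products, and \<open>f(z q\<^sup>N)\<close> tends to \<open>f(0) = 1\<close>.
\<close>

theorem q_binomial:
  assumes q: "norm q < 1" and z: "norm z < 1"
  shows "(\<lambda>n. qpoch a q n / qpoch q q n * z ^ n) sums (qpoch_inf (a * z) q / qpoch_inf z q)"
proof -
  define c where "c n = qpoch a q n / qpoch q q n" for n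
  define f where "f w = (\<Sum>n. c n * w ^ n)" for w
  have nz: "q * q ^ n \<noteq> 1" for n using q q by (rule mult_power_neq_one)
  have smn: "summable (\<lambda>n. c n * w ^ n)" if "norm w < 1" for w
    using summable_norm_Bseq_power[OF Bseq_qpoch_ratio[OF q nz] that, of a]
    unfolding c_def by (rule summable_norm_cancel)
  have crec: "c (Suc n) * (1 - q ^ Suc n) = c n * (1 - a * q ^ n)" for n
    using nz[of n] qpoch_nonzero[of q q n, OF nz] by (simp add: c_def qpoch_Suc field_simps)
  have step: "(1 - w) * f w = (1 - a * w) * f (w * q)" if w: "norm w < 1" for w
  proof -
    have wq: "norm (w * q) < 1"
      using w q by (metis mult_strict_mono' norm_ge_zero norm_mult mult_1)
    have "(\<lambda>n. c n * w ^ n - c n * (w * q) ^ n) sums (f w - f (w * q))"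
      unfolding f_def by (intro sums_diff summable_sums smn w wq)
    hence "(\<lambda>n. c n * (1 - q ^ n) * w ^ n) sums (f w - f (w * q))"
      by (simp add: algebra_simps power_mult_distrib)
    hence "(\<lambda>n. c (Suc n) * (1 - q ^ Suc n) * w ^ Suc n) sums (f w - f (w * q))"
      using sums_Suc_iff[of "\<lambda>n. c n * (1 - q ^ n) * w ^ n" "f w - f (w * q)"] by simp
    hence "(\<lambda>n. c n * (1 - a * q ^ n) * w ^ Suc n) sums (f w - f (w * q))"
      by (simp only: crec)
    moreover have "(\<lambda>n. w * (c n * w ^ n) - a * w * (c n * (w * q) ^ n)) sums (w * f w - a * w * f (w * q))"
      unfolding f_def by (intro sums_diff sums_mult summable_sums smn w wq)
    hence "(\<lambda>n. c n * (1 - a * q ^ n) * w ^ Suc n) sums (w * f w - a * w * f (w * q))"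
      by (simp add: algebra_simps power_mult_distrib)
    ultimately have "f w - f (w * q) = w * f w - a * w * f (w * q)"
      by (rule sums_unique2)
    thus ?thesis by (simp add: algebra_simps)
  qed
  note wN = norm_mult_power_less_one[OF q z]
  have iter: "qpoch z q N * f z = qpoch (a * z) q N * f (z * q ^ N)" for N
  proof (induction N)
    case (Suc N)
    have "qpoch z q (Suc N) * f z = (1 - z * q ^ N) * (qpoch z q N * f z)"
      by (simp add: qpoch_Suc)
    also have "\<dots> = qpoch (a * z) q N * ((1 - z * q ^ N) * f (z * q ^ N))"
      by (simp add: Suc.IH)
    also have "\<dots> = qpoch (a * z) q (Suc N) * f (z * q ^ Suc N)"
      by (simp only: step[OF wN]) (simp add: qpoch_Suc mult_ac)
    finally show ?case .
  qed simp
  have "isCont f 0"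
    unfolding f_def using smn[of "1/2"] by (intro isCont_powser[where K = "1/2"]) (auto simp: norm_divide)
  moreover have "(\<lambda>N. z * q ^ N) \<longlonglongrightarrow> z * 0"
    using q by (intro tendsto_intros LIMSEQ_power_zero)
  ultimately have "(\<lambda>N. f (z * q ^ N)) \<longlonglongrightarrow> f 0"
    by (intro isCont_tendsto_compose[of 0 f]) auto
  moreover have "f 0 = 1" unfolding f_def powser_zero by (simp add: c_def)
  ultimately have "(\<lambda>N. qpoch (a * z) q N * f (z * q ^ N)) \<longlonglongrightarrow> qpoch_inf (a * z) q * 1"
    by (intro tendsto_mult qpoch_tendsto q) simp
  moreover have "(\<lambda>N. qpoch z q N * f z) \<longlonglongrightarrow> qpoch_inf z q * f z"
    by (intro tendsto_intros qpoch_tendsto q)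
  ultimately have "qpoch_inf z q * f z = qpoch_inf (a * z) q"
    using LIMSEQ_unique by (fastforce simp: iter)
  moreover have "qpoch_inf z q \<noteq> 0"
    using q z by (intro qpoch_inf_nonzero mult_power_neq_one)
  ultimately have "f z = qpoch_inf (a * z) q / qpoch_inf z q"
    by (simp add: field_simps)
  thus ?thesis
    using summable_sums[OF smn[OF z]] by (simp add: f_def c_def)
qed

lemma q_binomial_infsum:
  assumes q: "norm q < 1" and z: "norm z < 1"
  shows "(\<Sum>\<^sub>\<infinity>n. qpoch a q n / qpoch q q n * z ^ n) = qpoch_inf (a * z) q / qpoch_inf z q"
proof -
  have "summable (\<lambda>n. norm (qpoch a q n / qpoch q q n * z ^ n))"
    using assms by (intro summable_norm_Bseq_power Bseq_qpoch_ratio mult_power_neq_one)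
  thus ?thesis
    using q_binomial[OF assms] by (intro infsumI norm_summable_imp_has_sum)
qed

text \<open>
  The factor \<open>\<gamma>\<close> that couples the two variables allows one majorant to serve both for the
  kernel \<open>q\<^sup>n\<^sup>m\<close> of the next lemma and for the original double sum.
\<close>

lemma summable_on_product_Bseq_power:
  fixes \<alpha> \<beta> :: "nat \<Rightarrow> complex" and \<gamma> :: "nat \<times> nat \<Rightarrow> complex"
  assumes "Bseq \<alpha>" "Bseq \<beta>" "norm z < 1" "norm w < 1" "\<And>p. norm (\<gamma> p) \<le> K"
  shows "(\<lambda>(n, m). \<alpha> n * z ^ n * (\<beta> m * w ^ m) * \<gamma> (n, m)) summable_on UNIV"
proof -
  have "(\<lambda>n. norm (\<alpha> n * z ^ n)) summable_on UNIV" "(\<lambda>m. norm (\<beta> m * w ^ m)) summable_on UNIV"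
    using summable_norm_Bseq_power[OF assms(1,3)] summable_norm_Bseq_power[OF assms(2,4)]
    by (auto intro!: norm_summable_imp_summable_on)
  hence "(\<lambda>(n, m). norm (\<alpha> n * z ^ n) * norm (\<beta> m * w ^ m)) summable_on UNIV \<times> UNIV"
    by (intro summable_on_SigmaI[where g = "\<lambda>n. norm (\<alpha> n * z ^ n) * (\<Sum>\<^sub>\<infinity>m. norm (\<beta> m * w ^ m))"])
       (auto intro!: has_sum_cmult_right summable_on_cmult_left)
  hence "(\<lambda>p. (case p of (n, m) \<Rightarrow> norm (\<alpha> n * z ^ n) * norm (\<beta> m * w ^ m)) * K) summable_on UNIV \<times> UNIV"
    by (rule summable_on_cmult_left)
  hence "(\<lambda>p. norm (case p of (n, m) \<Rightarrow> \<alpha> n * z ^ n * (\<beta> m * w ^ m) * \<gamma> (n, m))) summable_on UNIV \<times> UNIV"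
    by (rule summable_on_comparison_test)
       (use assms(5) in \<open>auto simp: norm_mult mult.assoc [symmetric] intro!: mult_left_mono\<close>)
  thus ?thesis by (auto dest: abs_summable_summable)
qed

text \<open>
  Both sides are iterated sums of \<open>\<alpha>\<^sub>n \<beta>\<^sub>m z\<^sup>n w\<^sup>m q\<^sup>n\<^sup>m\<close>, whose kernel is
  symmetric in \<open>n\<close> and \<open>m\<close>.
\<close>

lemma q_kernel_swap:
  fixes \<alpha> \<beta> :: "nat \<Rightarrow> complex"
  assumes "Bseq \<alpha>" "Bseq \<beta>" "norm z < 1" "norm w < 1" "norm q < 1"
  shows "(\<Sum>\<^sub>\<infinity>n. \<alpha> n * z ^ n * (\<Sum>\<^sub>\<infinity>m. \<beta> m * (w * q ^ n) ^ m)) =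
         (\<Sum>\<^sub>\<infinity>m. \<beta> m * w ^ m * (\<Sum>\<^sub>\<infinity>n. \<alpha> n * (z * q ^ m) ^ n))"
proof -
  have "(\<lambda>(n, m). \<alpha> n * z ^ n * (\<beta> m * w ^ m) * (case (n, m) of (n, m) \<Rightarrow> q ^ (n * m))) summable_on UNIV \<times> UNIV"
    using summable_on_product_Bseq_power[OF assms(1-4), of "\<lambda>(n, m). q ^ (n * m)" 1] assms(5)
    by (simp add: case_prod_unfold norm_power power_le_one)
  hence "(\<Sum>\<^sub>\<infinity>n. \<Sum>\<^sub>\<infinity>m. \<alpha> n * z ^ n * (\<beta> m * w ^ m) * q ^ (n * m)) =
         (\<Sum>\<^sub>\<infinity>m. \<Sum>\<^sub>\<infinity>n. \<alpha> n * z ^ n * (\<beta> m * w ^ m) * q ^ (n * m))"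
    by (intro infsum_swap_banach) simp
  moreover have "\<alpha> n * z ^ n * (\<beta> m * w ^ m) * q ^ (n * m) = \<alpha> n * z ^ n * (\<beta> m * (w * q ^ n) ^ m)"
    "\<alpha> n * z ^ n * (\<beta> m * w ^ m) * q ^ (n * m) = \<beta> m * w ^ m * (\<alpha> n * (z * q ^ m) ^ n)" for n m
    by (simp_all add: power_mult_distrib power_mult [symmetric] mult_ac)
  ultimately show ?thesis
    by (metis (no_types, lifting) infsum_cong infsum_cmult_right')
qed

text \<open>
  Heine's transformation of \<open>\<^sub>2\<phi>\<^sub>1(a, b; d b; q, z)\<close>, with \<open>(b)\<^sub>n/(d b)\<^sub>n\<close> written through the infinite products
  starting at \<open>b q\<^sup>n\<close> and \<open>d b q\<^sup>n\<close>.  In this form the sides are mirror images under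
  exchanging \<open>(a, z)\<close> with \<open>(d, b)\<close>.
\<close>

theorem heine_symmetric:
  assumes "norm q < 1" "norm z < 1" "norm b < 1"
  shows "(\<Sum>\<^sub>\<infinity>n. qpoch a q n / qpoch q q n * z ^ n * (qpoch_inf (d * b * q ^ n) q / qpoch_inf (b * q ^ n) q)) =
         (\<Sum>\<^sub>\<infinity>m. qpoch d q m / qpoch q q m * b ^ m * (qpoch_inf (a * z * q ^ m) q / qpoch_inf (z * q ^ m) q))"
proof -
  note * = q_binomial_infsum[OF assms(1) norm_mult_power_less_one[OF assms(1)]]
  have B: "Bseq (\<lambda>n. qpoch c q n / qpoch q q n)" for c
    using assms by (intro Bseq_qpoch_ratio mult_power_neq_one)
  \<comment> \<open>By the q-binomial theorem, both inner sums of the exchanged double series are quotients of infinite products.\<close>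
  show ?thesis
    using q_kernel_swap[OF B B assms(2,3,1), of a d]
    unfolding *[OF assms(2)] *[OF assms(3)] by (simp only: mult.assoc)
qed

section \<open>The double sum\<close>

text \<open>
  Since \<open>(Q;Q)\<^sub>n (q\<^sup>2\<^sup>n\<^sup>+\<^sup>2;Q)\<^sub>k = (Q;Q)\<^sub>n\<^sub>+\<^sub>k\<close>, and likewise for the denominator, the
  variables are coupled only through \<open>n + k\<close>.
\<close>

lemma F2_term_factor:
  assumes q: "norm q < 1"
  shows "F2_term q (k, n) = q\<^sup>2 * ((q\<^sup>2) ^ k *
    (qpoch (q ^ 5) (q\<^sup>2) n / qpoch (q\<^sup>2) (q\<^sup>2) n * q ^ n) *
    (qpoch (q\<^sup>2) (q\<^sup>2) (n + k) / qpoch (q ^ 5) (q\<^sup>2) (n + k)))"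
proof -
  have "qpoch (q ^ i) (q\<^sup>2) n \<noteq> 0" if "0 < i" for i
    using q that by (intro qpoch_nonzero mult_power_neq_one norm_power_less_one) auto
  hence "qpoch (q\<^sup>2) (q\<^sup>2) n \<noteq> 0" "qpoch (q ^ 5) (q\<^sup>2) n \<noteq> 0"
    by auto
  moreover have e: "q ^ (2 * n + 2) = q\<^sup>2 * (q\<^sup>2) ^ n" "q ^ (2 * n + 5) = q ^ 5 * (q\<^sup>2) ^ n"
      "q ^ (2 * k + n + 2) = q\<^sup>2 * (q\<^sup>2) ^ k * q ^ n"
    by (simp_all only: power_add power_mult) (simp_all add: mult_ac)
  ultimately show ?thesis
    unfolding F2_term_def prod.case e qpoch_add by simp
qed

lemma F2_term_summable:
  assumes q: "norm q < 1"
  shows "F2_term q summable_on UNIV"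
proof -
  have nz: "q ^ i * (q\<^sup>2) ^ n \<noteq> 1" if "0 < i" for i n
    using q that by (intro mult_power_neq_one norm_power_less_one) auto
  have B: "Bseq (\<lambda>n. qpoch a (q\<^sup>2) n / qpoch (q ^ i) (q\<^sup>2) n)" if "0 < i" for a i
    using q that by (intro Bseq_qpoch_ratio nz norm_power_less_one) auto
  obtain K where K: "\<And>n. norm (qpoch (q\<^sup>2) (q\<^sup>2) n / qpoch (q ^ 5) (q\<^sup>2) n) \<le> K"
    using B[of 5 "q\<^sup>2"] by (auto simp: Bseq_def)
  have "(\<lambda>(k, n). 1 * (q\<^sup>2) ^ k * (qpoch (q ^ 5) (q\<^sup>2) n / qpoch (q\<^sup>2) (q\<^sup>2) n * q ^ n) *
    (case (k, n) of (k, n) \<Rightarrow> qpoch (q\<^sup>2) (q\<^sup>2) (n + k) / qpoch (q ^ 5) (q\<^sup>2) (n + k))) summable_on UNIV"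
    using q K by (intro summable_on_product_Bseq_power[where K = K] B norm_power_less_one) auto
  hence "(\<lambda>p. q\<^sup>2 * (case p of (k, n) \<Rightarrow> 1 * (q\<^sup>2) ^ k * (qpoch (q ^ 5) (q\<^sup>2) n / qpoch (q\<^sup>2) (q\<^sup>2) n * q ^ n) *
    (case (k, n) of (k, n) \<Rightarrow> qpoch (q\<^sup>2) (q\<^sup>2) (n + k) / qpoch (q ^ 5) (q\<^sup>2) (n + k)))) summable_on UNIV"
    by (rule summable_on_cmult_right)
  also have "?this \<longleftrightarrow> ?thesis"
    by (intro summable_on_cong) (auto simp: F2_term_factor[OF q] split: prod.splits)
  finally show ?thesis .
qed

text \<open>
  Heine's transformation applies to the sum over \<open>k\<close> with \<open>a = z = Q\<close>, where the
  coefficients \<open>(a)\<^sub>k/(Q)\<^sub>k\<close> are 1; on the other side \<open>(Q\<^sup>m\<^sup>+\<^sup>2)\<^sub>\<infinity>/(Q\<^sup>m\<^sup>+\<^sup>1)\<^sub>\<infinity>\<close> collapses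
  to \<open>1/(1 - Q\<^sup>m\<^sup>+\<^sup>1)\<close>.  The result depends on \<open>n\<close> through \<open>Q\<^sup>n\<^sup>m\<close> only, so the sum
  over \<open>n\<close> becomes a q-binomial series after an exchange.
\<close>

lemma F2_double_sum_eq_single_sum:
  assumes q: "norm q < 1"
  defines "Q \<equiv> q\<^sup>2"
  shows "(\<Sum>\<^sub>\<infinity>p. F2_term q p) = q\<^sup>2 * (qpoch_inf Q Q)\<^sup>2 / (qpoch_inf (q ^ 5) Q * qpoch_inf q Q) *
    (\<Sum>\<^sub>\<infinity>m. qpoch q Q m * qpoch (q ^ 3) Q m / (qpoch Q Q (m + 1) * qpoch Q Q (m + 2)) * Q ^ m)"
proof -
  have Q: "norm Q < 1" using q by (simp add: Q_def norm_power_less_one)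
  have nz: "a * Q ^ n \<noteq> 1" if "norm a < 1" for a n
    using Q that by (intro mult_power_neq_one)
  have qi: "norm (q ^ i) < 1" if "0 < i" for i
    using q that by (rule norm_power_less_one)
  have inz: "qpoch_inf a Q \<noteq> 0" if "norm a < 1" for a
    using Q nz that by (intro qpoch_inf_nonzero)
  have fnz: "qpoch a Q n \<noteq> 0" if "norm a < 1" for a n
    using nz that by (intro qpoch_nonzero)
  have inz': "qpoch_inf (a * Q ^ n) Q \<noteq> 0" if "norm a < 1" for a n
    using Q that by (intro inz norm_mult_power_less_one)
  have ratio: "qpoch a Q n / qpoch b Q n = qpoch_inf a Q / qpoch_inf b Q * (qpoch_inf (b * Q ^ n) Q / qpoch_inf (a * Q ^ n) Q)"
    if "norm a < 1" "norm b < 1" for a b n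
    using qpoch_inf_split[OF Q, of a n] qpoch_inf_split[OF Q, of b n] inz'[OF that(1), of n] inz'[OF that(2), of n] fnz[OF that(2), of n]
    by (simp add: field_simps)
  define \<alpha> where "\<alpha> n = qpoch (q ^ 5) Q n / qpoch Q Q n" for n
  define \<beta> where "\<beta> m = qpoch (q ^ 3) Q m / qpoch Q Q (m + 1)" for m
  define C where "C = qpoch_inf Q Q / qpoch_inf (q ^ 5) Q"

  have inner: "(\<Sum>\<^sub>\<infinity>k. Q ^ k * (qpoch Q Q (n + k) / qpoch (q ^ 5) Q (n + k))) = C * (\<Sum>\<^sub>\<infinity>m. \<beta> m * (Q * Q ^ n) ^ m)" for n
  proof -
    have b: "norm (Q * Q ^ n) < 1" using Q by (intro norm_mult_power_less_one)
    have "(\<Sum>\<^sub>\<infinity>k. Q ^ k * (qpoch Q Q (n + k) / qpoch (q ^ 5) Q (n + k))) =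
      (\<Sum>\<^sub>\<infinity>k. C * (qpoch Q Q k / qpoch Q Q k * Q ^ k * (qpoch_inf (q ^ 3 * (Q * Q ^ n) * Q ^ k) Q / qpoch_inf (Q * Q ^ n * Q ^ k) Q)))"
    proof (rule infsum_cong)
      fix k
      have "q ^ 5 = q ^ 3 * Q" by (simp add: Q_def flip: power_add)
      thus "Q ^ k * (qpoch Q Q (n + k) / qpoch (q ^ 5) Q (n + k)) =
        C * (qpoch Q Q k / qpoch Q Q k * Q ^ k * (qpoch_inf (q ^ 3 * (Q * Q ^ n) * Q ^ k) Q / qpoch_inf (Q * Q ^ n * Q ^ k) Q))"
        unfolding ratio[OF Q qi[of 5, simplified]] C_def
        using fnz[OF Q, of k] by (simp add: power_add mult_ac)
    qed
    also have "\<dots> = C * (\<Sum>\<^sub>\<infinity>m. qpoch (q ^ 3) Q m / qpoch Q Q m * (Q * Q ^ n) ^ m *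
        (qpoch_inf (Q * Q * Q ^ m) Q / qpoch_inf (Q * Q ^ m) Q))"
      by (subst infsum_cmult_right', subst heine_symmetric[OF Q Q b]) (rule refl)
    also have "(\<lambda>m. qpoch (q ^ 3) Q m / qpoch Q Q m * (Q * Q ^ n) ^ m *
        (qpoch_inf (Q * Q * Q ^ m) Q / qpoch_inf (Q * Q ^ m) Q)) = (\<lambda>m. \<beta> m * (Q * Q ^ n) ^ m)"
    proof
      fix m
      show "qpoch (q ^ 3) Q m / qpoch Q Q m * (Q * Q ^ n) ^ m *
        (qpoch_inf (Q * Q * Q ^ m) Q / qpoch_inf (Q * Q ^ m) Q) = \<beta> m * (Q * Q ^ n) ^ m"
        using qpoch_inf_split[OF Q, of "Q * Q ^ m" 1] inz'[OF Q, of m] inz'[OF Q, of "Suc m"]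
        by (simp add: \<beta>_def qpoch_Suc mult_ac divide_simps)
    qed
    finally show ?thesis .
  qed

  have B\<alpha>: "Bseq \<alpha>"
    unfolding \<alpha>_def using Q nz by (intro Bseq_qpoch_ratio)
  \<comment> \<open>\<open>(Q;Q)\<^sub>m\<^sub>+\<^sub>1 = (1 - Q) (Q\<^sup>2;Q)\<^sub>m\<close> turns \<open>\<beta>\<close> into a quotient of products of equal length.\<close>
  have "Bseq (\<lambda>m. 1 / (1 - Q) * (qpoch (q ^ 3) Q m / qpoch (Q * Q) Q m))"
    using Q norm_mult_power_less_one[OF Q Q, of 1] nz
    by (intro Bseq_mult Bseq_qpoch_ratio) auto
  hence B\<beta>: "Bseq \<beta>"
    by (simp add: \<beta>_def [abs_def] qpoch_Suc')

  have tail: "(\<Sum>\<^sub>\<infinity>n. \<alpha> n * (q * Q ^ m) ^ n) = qpoch_inf Q Q / qpoch_inf q Q * (qpoch q Q m / qpoch Q Q (m + 2))" for m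
  proof -
    have "(\<Sum>\<^sub>\<infinity>n. \<alpha> n * (q * Q ^ m) ^ n) = qpoch_inf (q ^ 5 * (q * Q ^ m)) Q / qpoch_inf (q * Q ^ m) Q"
      unfolding \<alpha>_def using Q q by (intro q_binomial_infsum norm_mult_power_less_one)
    also have "q ^ 5 * (q * Q ^ m) = Q * Q ^ (m + 2)"
      by (simp add: Q_def power_add flip: power_Suc power_mult) (simp add: power_numeral_reduce)
    finally show ?thesis
      using qpoch_inf_split[OF Q, of Q "m + 2"] qpoch_inf_split[OF Q, of q m] inz'[OF q, of m] fnz[OF Q, of "m + 2"] fnz[OF q, of m]
      by (simp add: field_simps)
  qed

  have "(\<Sum>\<^sub>\<infinity>p. F2_term q p) = (\<Sum>\<^sub>\<infinity>k. \<Sum>\<^sub>\<infinity>n. F2_term q (k, n))"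
    using infsum_Sigma_banach[of "F2_term q" UNIV "\<lambda>_. UNIV"] F2_term_summable[OF q] by simp
  also have "\<dots> = (\<Sum>\<^sub>\<infinity>n. \<Sum>\<^sub>\<infinity>k. F2_term q (k, n))"
    using F2_term_summable[OF q] by (intro infsum_swap_banach) simp
  also have "\<dots> = (\<Sum>\<^sub>\<infinity>n. q\<^sup>2 * C * (\<alpha> n * q ^ n * (\<Sum>\<^sub>\<infinity>m. \<beta> m * (Q * Q ^ n) ^ m)))"
  proof (rule infsum_cong)
    fix n
    have "F2_term q (k, n) = (q\<^sup>2 * (\<alpha> n * q ^ n)) * (Q ^ k * (qpoch Q Q (n + k) / qpoch (q ^ 5) Q (n + k)))" for k
      by (simp add: F2_term_factor[OF q] \<alpha>_def Q_def)
    hence "(\<Sum>\<^sub>\<infinity>k. F2_term q (k, n)) = (q\<^sup>2 * (\<alpha> n * q ^ n)) * (\<Sum>\<^sub>\<infinity>k. Q ^ k * (qpoch Q Q (n + k) / qpoch (q ^ 5) Q (n + k)))"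
      by (simp only: infsum_cmult_right')
    thus "(\<Sum>\<^sub>\<infinity>k. F2_term q (k, n)) = q\<^sup>2 * C * (\<alpha> n * q ^ n * (\<Sum>\<^sub>\<infinity>m. \<beta> m * (Q * Q ^ n) ^ m))"
      by (simp only: inner mult_ac)
  qed
  also have "\<dots> = q\<^sup>2 * C * (\<Sum>\<^sub>\<infinity>n. \<alpha> n * q ^ n * (\<Sum>\<^sub>\<infinity>m. \<beta> m * (Q * Q ^ n) ^ m))"
    by (rule infsum_cmult_right')
  also have "\<dots> = q\<^sup>2 * C * (\<Sum>\<^sub>\<infinity>m. \<beta> m * Q ^ m * (\<Sum>\<^sub>\<infinity>n. \<alpha> n * (q * Q ^ m) ^ n))"
    by (subst q_kernel_swap[OF B\<alpha> B\<beta> q Q Q]) (rule refl)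
  also have "\<dots> = q\<^sup>2 * C * (\<Sum>\<^sub>\<infinity>m. qpoch_inf Q Q / qpoch_inf q Q *
      (qpoch q Q m * qpoch (q ^ 3) Q m / (qpoch Q Q (m + 1) * qpoch Q Q (m + 2)) * Q ^ m))"
    unfolding tail by (simp add: \<beta>_def mult_ac)
  also have "\<dots> = q\<^sup>2 * C * (qpoch_inf Q Q / qpoch_inf q Q) * (\<Sum>\<^sub>\<infinity>m.
      qpoch q Q m * qpoch (q ^ 3) Q m / (qpoch Q Q (m + 1) * qpoch Q Q (m + 2)) * Q ^ m)"
    by (subst infsum_cmult_right') (simp only: mult.assoc)
  finally show ?thesis
    by (simp add: C_def power2_eq_square mult_ac)
qed

text \<open>
  The first parameter \<open>1/q\<close> is chosen so that \<open>(1/q;Q)\<^sub>m\<^sub>+\<^sub>1\<close> is a multiple of \<open>(q;Q)\<^sub>m\<close>,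
  which makes the shifted terms of the \<open>\<^sub>2\<phi>\<^sub>1\<close> series those of \<open>V\<close>; the summand \<open>1/(1 - Q)\<close> is
  the term of index 0.  On the transformed side \<open>(q\<^sup>3;Q)\<^sub>m/(q;Q)\<^sub>m\<close> telescopes to
  \<open>(1 - q\<^sup>2\<^sup>m\<^sup>+\<^sup>1)/(1 - q)\<close>, and only geometric series remain.
\<close>

lemma single_sum_by_heine:
  assumes q: "norm q < 1" "q \<noteq> 0"
  defines "Q \<equiv> q\<^sup>2"
  defines "V \<equiv> \<Sum>\<^sub>\<infinity>m. qpoch q Q m * qpoch (q ^ 3) Q m / (qpoch Q Q (m + 1) * qpoch Q Q (m + 2)) * Q ^ m"
  shows "qpoch_inf Q Q / qpoch_inf q Q * (1 / (1 - Q) - q * (1 - q)\<^sup>2 * V) =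
         qpoch_inf q Q / qpoch_inf Q Q * ((1 + q\<^sup>2) / ((1 - q) * (1 - q ^ 3)))"
proof -
  have Q: "norm Q < 1" using q by (simp add: Q_def norm_power_less_one)
  have nz: "a * Q ^ n \<noteq> 1" if "norm a < 1" for a n
    using Q that by (intro mult_power_neq_one)
  have qi: "norm (q ^ i) < 1" if "0 < i" for i
    using q(1) that by (rule norm_power_less_one)
  have inz: "qpoch_inf a Q \<noteq> 0" if "norm a < 1" for a
    using Q nz that by (intro qpoch_inf_nonzero)
  have fnz: "qpoch a Q n \<noteq> 0" if "norm a < 1" for a n
    using nz that by (intro qpoch_nonzero)
  have inz': "qpoch_inf (a * Q ^ n) Q \<noteq> 0" if "norm a < 1" for a n
    using Q that by (intro inz norm_mult_power_less_one)
  define t where "t M = qpoch (1 / q) Q M / qpoch Q Q M * Q ^ M * (qpoch_inf (q ^ 3 * q * Q ^ M) Q / qpoch_inf (q * Q ^ M) Q)" for M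
  define v where "v m = qpoch q Q m * qpoch (q ^ 3) Q m / (qpoch Q Q (m + 1) * qpoch Q Q (m + 2)) * Q ^ m" for m
  define P where "P = qpoch_inf Q Q / qpoch_inf q Q"

  have t0: "t 0 = P / (1 - Q)"
  proof -
    have "q ^ 3 * q = Q * Q" by (simp add: Q_def power_numeral_reduce)
    moreover have "qpoch_inf (Q * Q) Q = qpoch_inf Q Q / (1 - Q)"
      using qpoch_inf_split[OF Q, of Q 1] nz[OF Q, of 0] by (simp add: qpoch_Suc)
    ultimately show ?thesis by (simp add: t_def P_def)
  qed
  have tSuc: "t (Suc m) = - (P * (q * (1 - q)\<^sup>2)) * v m" for m
  proof -
    have 1: "qpoch (1 / q) Q (Suc m) = (1 - 1 / q) * qpoch q Q m"
      using q by (simp add: qpoch_Suc' Q_def power2_eq_square)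
    have e: "q ^ 3 * q * Q ^ Suc m = Q * Q ^ (m + 2)"
      by (simp add: Q_def power_numeral_reduce)
    have 2: "qpoch_inf (q ^ 3 * q * Q ^ Suc m) Q = qpoch_inf Q Q / qpoch Q Q (m + 2)"
      unfolding e using qpoch_inf_split[OF Q, of Q "m + 2"] fnz[OF Q, of "m + 2"] by (simp add: field_simps)
    have 3: "qpoch_inf (q * Q ^ Suc m) Q = qpoch_inf q Q / qpoch q Q (Suc m)"
      using qpoch_inf_split[OF Q, of q "Suc m"] fnz[OF q(1), of "Suc m"] by (simp add: field_simps)
    have 4: "qpoch q Q (Suc m) = (1 - q) * qpoch (q ^ 3) Q m"
      by (simp add: qpoch_Suc' Q_def power_numeral_reduce)
    have 5: "(1 - 1 / q) * (1 - q) * Q = - (q * (1 - q)\<^sup>2)"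
      using q by (simp add: Q_def field_simps power2_eq_square)
    have "t (Suc m) = ((1 - 1 / q) * (1 - q) * Q) * P * v m"
      unfolding t_def v_def P_def 1 2 3 4 by (simp add: mult_ac)
    thus ?thesis unfolding 5 by simp
  qed
  \<comment> \<open>Splitting off the term of index 0 requires convergence of the series, seen from its form with finite products.\<close>
  have "Bseq (\<lambda>M. qpoch (1 / q) Q M / qpoch Q Q M * (qpoch_inf (q ^ 4) Q / qpoch_inf q Q * (qpoch q Q M / qpoch (q ^ 4) Q M)))"
    using Q q qi nz by (intro Bseq_mult Bseq_qpoch_ratio) auto
  hence "summable (\<lambda>M. norm (qpoch (1 / q) Q M / qpoch Q Q M * (qpoch_inf (q ^ 4) Q / qpoch_inf q Q * (qpoch q Q M / qpoch (q ^ 4) Q M)) * Q ^ M))"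
    using Q by (intro summable_norm_Bseq_power)
  moreover have "qpoch (1 / q) Q M / qpoch Q Q M * (qpoch_inf (q ^ 4) Q / qpoch_inf q Q * (qpoch q Q M / qpoch (q ^ 4) Q M)) * Q ^ M = t M" for M
  proof -
    have "q ^ 3 * q = q ^ 4" by (simp add: power_numeral_reduce)
    thus ?thesis
      using qpoch_inf_split[OF Q, of q M] qpoch_inf_split[OF Q, of "q ^ 4" M] fnz[OF q(1), of M] fnz[of "q ^ 4" M] qi[of 4] inz'[OF q(1), of M]
      by (simp add: t_def field_simps)
  qed
  ultimately have st: "summable (\<lambda>M. norm (t M))" by simp
  hence "(t has_sum suminf t) UNIV"
    by (intro norm_summable_imp_has_sum summable_sums) (auto dest: summable_norm_cancel)
  hence "infsum t UNIV = suminf t" by (rule infsumI)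
  also have "suminf t = t 0 + (\<Sum>m. t (Suc m))"
    using suminf_split_head[OF summable_norm_cancel[OF st]] by simp
  also have "(\<Sum>m. t (Suc m)) = (\<Sum>\<^sub>\<infinity>m. t (Suc m))"
  proof -
    have "summable (\<lambda>m. norm (t (Suc m)))" using st by (subst summable_Suc_iff)
    hence "((\<lambda>m. t (Suc m)) has_sum (\<Sum>m. t (Suc m))) UNIV"
      by (intro norm_summable_imp_has_sum summable_sums) (auto dest: summable_norm_cancel)
    thus ?thesis by (simp add: infsumI)
  qed
  also have "\<dots> = - (P * (q * (1 - q)\<^sup>2)) * V"
    unfolding tSuc V_def v_def by (rule infsum_cmult_right')
  finally have left: "infsum t UNIV = P * (1 / (1 - Q) - q * (1 - q)\<^sup>2 * V)"
    by (simp add: t0 algebra_simps)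

  have "infsum t UNIV = (\<Sum>\<^sub>\<infinity>m. qpoch (q ^ 3) Q m / qpoch Q Q m * q ^ m * (qpoch_inf (1 / q * Q * Q ^ m) Q / qpoch_inf (Q * Q ^ m) Q))"
    unfolding t_def by (rule heine_symmetric[OF Q Q q(1)])
  also have "\<dots> = (\<Sum>\<^sub>\<infinity>m. inverse P / (1 - q) * (q ^ m - q * (q ^ 3) ^ m))"
  proof (rule infsum_cong)
    fix m
    have D: "1 / q * Q = q" using q by (simp add: Q_def power2_eq_square)
    have "qpoch q Q m * (1 - q * Q ^ m) = (1 - q) * qpoch (q ^ 3) Q m"
      using qpoch_Suc[of q Q m] by (simp add: qpoch_Suc' Q_def power_numeral_reduce)
    moreover have E: "q * (q ^ 3) ^ m = q * Q ^ m * q ^ m"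
      by (simp add: Q_def power_mult_distrib power_numeral_reduce)
    moreover have q1: "1 - q \<noteq> 0" using q by auto
    moreover have A: "qpoch_inf (q * Q ^ m) Q / qpoch_inf (Q * Q ^ m) Q = inverse P * (qpoch Q Q m / qpoch q Q m)"
      using qpoch_inf_split[OF Q, of q m] qpoch_inf_split[OF Q, of Q m] inz[OF q(1)] inz'[OF Q, of m] fnz[OF q(1), of m] fnz[OF Q, of m]
      by (simp add: P_def field_simps)
    ultimately have B: "qpoch (q ^ 3) Q m = qpoch q Q m * (1 - q * Q ^ m) / (1 - q)"
      by (simp add: field_simps)
    have "q ^ m - q * Q ^ m * q ^ m = (1 - q * Q ^ m) * q ^ m"
      by (simp add: algebra_simps)
    thus "qpoch (q ^ 3) Q m / qpoch Q Q m * q ^ m * (qpoch_inf (1 / q * Q * Q ^ m) Q / qpoch_inf (Q * Q ^ m) Q) =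
      inverse P / (1 - q) * (q ^ m - q * (q ^ 3) ^ m)"
      unfolding D A B E using fnz[OF q(1), of m] fnz[OF Q, of m] by (simp add: divide_inverse mult_ac) (simp add: field_simps)
  qed
  also have "\<dots> = inverse P / (1 - q) * (1 / (1 - q) - q * (1 / (1 - q ^ 3)))"
  proof -
    have g: "((\<lambda>m. w ^ m) has_sum 1 / (1 - w)) UNIV" if "norm w < 1" for w :: complex
      using that by (intro norm_summable_imp_has_sum geometric_sums) (simp_all add: norm_power summable_geometric)
    have "((\<lambda>m. inverse P / (1 - q) * (q ^ m + - q * (q ^ 3) ^ m)) has_sum inverse P / (1 - q) * (1 / (1 - q) + - q * (1 / (1 - q ^ 3)))) UNIV"
      using q qi by (intro has_sum_cmult_right has_sum_add g) auto
    thus ?thesis by (simp add: infsumI)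
  qed
  also have "\<dots> = inverse P * ((1 + q\<^sup>2) / ((1 - q) * (1 - q ^ 3)))"
  proof -
    have "1 - q \<noteq> 0" "1 - q ^ 3 \<noteq> 0" using q qi[of 3] by auto
    thus ?thesis by (simp add: divide_simps) algebra
  qed
  finally show ?thesis
    using left by (simp add: P_def)
qed

theorem F2_double_sum_eval:
  assumes q: "norm q < 1"
  shows "(\<Sum>\<^sub>\<infinity>p. F2_term q p) =
      q * (1 - q ^ 3) / ((1 - q) * (1 - q ^ 2))
        * (qpoch_inf (q ^ 2) (q ^ 2) ^ 2 / qpoch_inf q (q ^ 2) ^ 2)
      - q * (1 + q ^ 2) / (1 - q) ^ 2"
proof (cases "q = 0")
  case True
  hence "F2_term q p = 0" for p
    by (cases p) (simp add: F2_term_def)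
  thus ?thesis using True by simp
next
  case False
  define Q where "Q = q\<^sup>2"
  define V where "V = (\<Sum>\<^sub>\<infinity>m. qpoch q Q m * qpoch (q ^ 3) Q m / (qpoch Q Q (m + 1) * qpoch Q Q (m + 2)) * Q ^ m)"
  define P where "P = qpoch_inf Q Q / qpoch_inf q Q"
  have Q: "norm Q < 1" using q by (simp add: Q_def norm_power_less_one)
  have inz: "qpoch_inf (q ^ i) Q \<noteq> 0" if "0 < i" for i
    using q Q that by (intro qpoch_inf_nonzero mult_power_neq_one norm_power_less_one)
  have P: "P \<noteq> 0" using inz[of 1] inz[of 2] by (simp add: P_def Q_def)
  have "norm (q ^ 3) < 1" using q by (rule norm_power_less_one) simp
  hence nz: "1 - q \<noteq> 0" "1 - Q \<noteq> 0" "1 - q ^ 3 \<noteq> 0"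
    using q Q by auto
  have "qpoch_inf q Q = (1 - q) * (1 - q ^ 3) * qpoch_inf (q ^ 5) Q"
    using qpoch_inf_split[OF Q, of q 2]
    by (simp add: qpoch_Suc Q_def eval_nat_numeral mult.assoc)
  hence "q\<^sup>2 * (qpoch_inf Q Q)\<^sup>2 / (qpoch_inf (q ^ 5) Q * qpoch_inf q Q) = q\<^sup>2 * P\<^sup>2 * (1 - q) * (1 - q ^ 3)"
    using nz inz[of 5] by (simp add: P_def power2_eq_square divide_simps)
  hence sum_eq: "(\<Sum>\<^sub>\<infinity>p. F2_term q p) = q\<^sup>2 * P\<^sup>2 * (1 - q) * (1 - q ^ 3) * V"
    using F2_double_sum_eq_single_sum[OF q] by (simp add: Q_def V_def)
  have "P * (1 / (1 - Q) - q * (1 - q)\<^sup>2 * V) = inverse P * ((1 + q\<^sup>2) / ((1 - q) * (1 - q ^ 3)))"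
    using single_sum_by_heine[OF q False] by (simp add: P_def V_def Q_def)
  hence "P * (P * (1 / (1 - Q) - q * (1 - q)\<^sup>2 * V)) = (1 + q\<^sup>2) / ((1 - q) * (1 - q ^ 3))"
    using P by simp
  hence "P\<^sup>2 * q * (1 - q)\<^sup>2 * V = P\<^sup>2 / (1 - Q) - (1 + q\<^sup>2) / ((1 - q) * (1 - q ^ 3))"
    by (simp add: power2_eq_square algebra_simps)
  hence "q * (1 - q ^ 3) / (1 - q) * (P\<^sup>2 * q * (1 - q)\<^sup>2 * V) =
         q * (1 - q ^ 3) / (1 - q) * (P\<^sup>2 / (1 - Q) - (1 + q\<^sup>2) / ((1 - q) * (1 - q ^ 3)))"
    by simp
  also have "q * (1 - q ^ 3) / (1 - q) * (P\<^sup>2 * q * (1 - q)\<^sup>2 * V) = q\<^sup>2 * P\<^sup>2 * (1 - q) * (1 - q ^ 3) * V"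
    using nz by (simp add: power2_eq_square)
  also have "q * (1 - q ^ 3) / (1 - q) * (P\<^sup>2 / (1 - Q) - (1 + q\<^sup>2) / ((1 - q) * (1 - q ^ 3))) =
    q * (1 - q ^ 3) / ((1 - q) * (1 - Q)) * P\<^sup>2 - q * (1 + q\<^sup>2) / (1 - q)\<^sup>2"
    unfolding right_diff_distrib[of "q * (1 - q ^ 3) / (1 - q)"]
    using nz by (simp add: power2_eq_square)
  finally show ?thesis
    by (simp add: sum_eq P_def Q_def power_divide)
qed

section \<open>Functions on the disc with integer Taylor coefficients\<close>

definition integer_taylor :: "(complex \<Rightarrow> complex) \<Rightarrow> bool" where
  "integer_taylor f \<longleftrightarrow> f holomorphic_on ball 0 1 \<and> (\<forall>n. fps_nth (fps_expansion f 0) n \<in> \<int>)"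

lemma integer_taylorI:
  assumes "f holomorphic_on ball 0 1" "f has_fps_expansion F" "\<And>n. fps_nth F n \<in> \<int>"
  shows "integer_taylor f"
  using assms fps_expansion_eqI[OF assms(2)] by (simp add: integer_taylor_def)

lemma integer_taylorE:
  assumes "integer_taylor f"
  obtains F where "f holomorphic_on ball 0 1" "f has_fps_expansion F" "\<And>n. fps_nth F n \<in> \<int>"
  using assms has_fps_expansion_fps_expansion[of "ball 0 1" f]
  by (auto simp: integer_taylor_def)

lemma integer_taylor_const: "integer_taylor (\<lambda>_. of_int c)"
  by (rule integer_taylorI[of _ "fps_const (of_int c)"]) auto

lemma integer_taylor_1: "integer_taylor (\<lambda>_. 1)"
  using integer_taylor_const[of 1] by simp

lemma integer_taylor_ident: "integer_taylor (\<lambda>q. q)"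
  by (rule integer_taylorI[of _ fps_X]) (auto intro: fps_expansion_intros)

lemma integer_taylor_add:
  assumes "integer_taylor f" "integer_taylor g"
  shows "integer_taylor (\<lambda>q. f q + g q)"
proof -
  obtain F where F: "f holomorphic_on ball 0 1" "f has_fps_expansion F" "\<And>n. fps_nth F n \<in> \<int>"
    using assms(1) by (rule integer_taylorE) blast
  obtain G where G: "g holomorphic_on ball 0 1" "g has_fps_expansion G" "\<And>n. fps_nth G n \<in> \<int>"
    using assms(2) by (rule integer_taylorE) blast
  show ?thesis
    using F G by (intro integer_taylorI[of _ "F + G"] holomorphic_intros fps_expansion_intros) auto
qed

lemma integer_taylor_mult:
  assumes "integer_taylor f" "integer_taylor g"
  shows "integer_taylor (\<lambda>q. f q * g q)"
proof -
  obtain F where F: "f holomorphic_on ball 0 1" "f has_fps_expansion F" "\<And>n. fps_nth F n \<in> \<int>"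
    using assms(1) by (rule integer_taylorE) blast
  obtain G where G: "g holomorphic_on ball 0 1" "g has_fps_expansion G" "\<And>n. fps_nth G n \<in> \<int>"
    using assms(2) by (rule integer_taylorE) blast
  show ?thesis
    using F G by (intro integer_taylorI[of _ "F * G"] holomorphic_intros fps_expansion_intros)
      (auto simp: fps_mult_nth intro!: Ints_sum)
qed

lemma integer_taylor_diff:
  assumes "integer_taylor f" "integer_taylor g"
  shows "integer_taylor (\<lambda>q. f q - g q)"
  using integer_taylor_add[OF assms(1) integer_taylor_mult[OF integer_taylor_const[of "-1"] assms(2)]]
  by simp

lemma integer_taylor_power:
  assumes "integer_taylor f"
  shows "integer_taylor (\<lambda>q. f q ^ n)"
  by (induction n) (auto intro: integer_taylor_1 integer_taylor_mult assms)

text \<open>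
  The constant coefficient being 1, the recursion for the coefficients of the reciprocal involves no division.
\<close>

lemma integer_taylor_inverse:
  assumes "integer_taylor f" "f 0 = 1" "\<And>q. norm q < 1 \<Longrightarrow> f q \<noteq> 0"
  shows "integer_taylor (\<lambda>q. inverse (f q))"
proof -
  obtain F where F: "f holomorphic_on ball 0 1" "f has_fps_expansion F" "\<And>n. fps_nth F n \<in> \<int>"
    using assms(1) by (rule integer_taylorE) blast
  have F0: "fps_nth F 0 = 1"
    using has_fps_expansion_imp_0_eq_fps_nth_0[OF F(2)] assms(2) by simp
  have "fps_nth (inverse F) n \<in> \<int>" for n
  proof (induction n rule: less_induct)
    case (less n)
    show ?case
    proof (cases n)
      case 0
      thus ?thesis by (simp add: F0)
    next
      case (Suc m)
      have "inverse F * F = 1" using F0 by (intro inverse_mult_eq_1) simp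
      hence "0 = fps_nth (inverse F * F) n" using Suc by simp
      also have "\<dots> = (\<Sum>i=0..m. fps_nth (inverse F) i * fps_nth F (n - i)) + fps_nth (inverse F) n"
        using Suc F0 by (simp add: fps_mult_nth)
      finally have "fps_nth (inverse F) n = - (\<Sum>i=0..m. fps_nth (inverse F) i * fps_nth F (n - i))"
        by (simp add: eq_neg_iff_add_eq_0 add.commute)
      also have "\<dots> \<in> \<int>"
        using less Suc F(3) by (intro Ints_minus Ints_sum Ints_mult) auto
      finally show ?thesis .
    qed
  qed
  thus ?thesis
    using F assms(3) F0 by (intro integer_taylorI[of _ "inverse F"] holomorphic_intros fps_expansion_intros) auto
qed

lemma integer_taylor_prod:
  "(\<And>i. i \<in> A \<Longrightarrow> integer_taylor (f i)) \<Longrightarrow> integer_taylor (\<lambda>q. \<Prod>i\<in>A. f i q)"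
  by (induction A rule: infinite_finite_induct) (auto intro: integer_taylor_1 integer_taylor_mult)

text \<open>
  Locally uniform convergence carries over to derivatives at 0, so each Taylor coefficient of the limit is a
  limit of integers.
\<close>

lemma integer_taylor_uniform_limit:
  assumes "\<And>n. integer_taylor (f n)"
    and lim: "\<And>r. r < 1 \<Longrightarrow> uniform_limit (cball 0 r) f g sequentially"
  shows "integer_taylor g"
proof -
  have holo: "f n holomorphic_on ball 0 1" for n
    using assms(1) by (simp add: integer_taylor_def)
  have "g holomorphic_on ball 0 1"
  proof (rule holomorphic_uniform_sequence[OF open_ball holo])
    fix x :: complex assume x: "x \<in> ball 0 1"
    define d where "d = (1 - norm x) / 2"
    have sub: "cball x d \<subseteq> cball 0 (norm x + d)"
      by (auto simp: dist_norm) (smt (verit) norm_triangle_sub norm_minus_commute)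
    moreover have "norm x + d < 1" "0 < d" using x by (auto simp: d_def field_simps)
    moreover have "cball x d \<subseteq> ball 0 1"
      using sub \<open>norm x + d < 1\<close> by auto
    ultimately show "\<exists>d>0. cball x d \<subseteq> ball 0 1 \<and> uniform_limit (cball x d) f g sequentially"
      using uniform_limit_on_subset[OF lim] by blast
  qed
  moreover have "fps_nth (fps_expansion g 0) m \<in> \<int>" for m
  proof -
    have "uniform_limit (ball 0 (1/2)) f g sequentially"
      by (rule uniform_limit_on_subset[OF lim[of "1/2"]]) auto
    hence "(\<lambda>n. (deriv ^^ m) (f n) 0) \<longlonglongrightarrow> (deriv ^^ m) g 0"
      by (rule higher_deriv_complex_uniform_limit)
         (auto intro!: always_eventually holomorphic_on_subset[OF holo])
    hence "(\<lambda>n. (deriv ^^ m) (f n) 0 / fact m) \<longlonglongrightarrow> (deriv ^^ m) g 0 / fact m"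
      by (intro tendsto_divide tendsto_const) auto
    moreover have "(deriv ^^ m) (f n) 0 / fact m \<in> \<int>" for n
      using assms(1)[of n] by (simp add: integer_taylor_def fps_expansion_def)
    ultimately have "(deriv ^^ m) g 0 / fact m \<in> \<int>"
      by (intro Lim_in_closed_set[of \<int> _ sequentially]) auto
    thus ?thesis by (simp add: fps_expansion_def)
  qed
  ultimately show ?thesis by (simp add: integer_taylor_def)
qed

lemma integer_taylor_unique_coeffs:
  assumes "integer_taylor f"
  shows "\<exists>!F :: nat \<Rightarrow> int. \<forall>q. norm q < 1 \<longrightarrow> (\<lambda>n. of_int (F n) * q ^ n) sums f q"
proof -
  obtain G where G: "f holomorphic_on ball 0 1" "f has_fps_expansion G" "\<And>n. fps_nth G n \<in> \<int>"
    using assms(1) by (rule integer_taylorE) blast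
  have "\<forall>n. \<exists>k. fps_nth G n = of_int k"
    using G(3) by (auto elim: Ints_cases)
  then obtain F :: "nat \<Rightarrow> int" where F: "\<And>n. fps_nth G n = of_int (F n)"
    by metis
  show ?thesis
  proof (intro ex1I[of _ F] allI impI)
    fix q :: complex assume "norm q < 1"
    thus "(\<lambda>n. of_int (F n) * q ^ n) sums f q"
      using has_fps_expansion_imp_sums_complex[OF G(2), of 1 q] G(1) by (simp add: F one_ereal_def)
  next
    fix F' :: "nat \<Rightarrow> int"
    assume F': "\<forall>q. norm q < 1 \<longrightarrow> (\<lambda>n. of_int (F' n) * q ^ n) sums f q"
    have "f has_fps_expansion Abs_fps (\<lambda>n. of_int (F' n))"
    proof (rule has_fps_expansionI)
      show "\<forall>\<^sub>F u in nhds 0. (\<lambda>n. fps_nth (Abs_fps (\<lambda>n. of_int (F' n))) n * u ^ n) sums f u"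
        using F' eventually_mono[OF eventually_nhds_in_open[of "ball 0 1" "0 :: complex"]] by simp
    qed
    hence "G = Abs_fps (\<lambda>n. of_int (F' n))"
      using G(2) fps_expansion_unique_complex by blast
    hence "(of_int (F n) :: complex) = of_int (F' n)" for n
      using F[of n] by simp
    thus "F' = F" by auto
  qed
qed

text \<open>
  On \<open>|q| \<le> r\<close> the factors deviate from 1 by at most \<open>r\<^sup>j\<close>, so the partial products converge
  uniformly there; they are polynomials with integer coefficients.
\<close>

lemma qpoch_inf_integer_taylor:
  assumes "0 < a" "0 < b"
  shows "integer_taylor (\<lambda>q. qpoch_inf (q ^ a) (q ^ b))"
proof (rule integer_taylor_uniform_limit)
  fix n
  show "integer_taylor (\<lambda>q. \<Prod>j<n. 1 - q ^ a * (q ^ b) ^ j)"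
    by (intro integer_taylor_prod integer_taylor_diff integer_taylor_1 integer_taylor_mult
        integer_taylor_power integer_taylor_ident)
next
  fix r :: real assume r: "r < 1"
  have "uniformly_convergent_on (cball 0 r) (\<lambda>N q::complex. \<Sum>j<N. norm ((1 - q ^ a * (q ^ b) ^ j) - 1))"
  proof (rule Weierstrass_m_test')
    fix j and q :: complex assume q: "q \<in> cball 0 r"
    hence "0 \<le> r" by (auto intro: order.trans[OF norm_ge_zero])
    have "norm (q ^ a * (q ^ b) ^ j) = norm q ^ (a + b * j)"
      by (simp add: norm_mult norm_power power_add power_mult)
    also have "\<dots> \<le> r ^ (a + b * j)"
      using q by (intro power_mono) auto
    also have "\<dots> \<le> r ^ j"
      using r \<open>0 \<le> r\<close> assms by (intro power_decreasing) (auto simp: trans_le_add2)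
    \<comment> \<open>For \<open>r < 0\<close> the disc is empty, but the majorant has to be summable all the same.\<close>
    finally show "norm (norm ((1 - q ^ a * (q ^ b) ^ j) - 1)) \<le> max r 0 ^ j"
      using \<open>0 \<le> r\<close> by simp
  qed (use r in \<open>auto intro!: summable_geometric\<close>)
  hence "uniformly_convergent_on (cball 0 r) (\<lambda>N q::complex. \<Prod>j<N. 1 - q ^ a * (q ^ b) ^ j)"
    by (intro uniformly_convergent_on_prod') (auto intro!: continuous_intros)
  then obtain l where l: "uniform_limit (cball 0 r) (\<lambda>N q::complex. \<Prod>j<N. 1 - q ^ a * (q ^ b) ^ j) l sequentially"
    by (auto simp: uniformly_convergent_on_def)
  have "l q = qpoch_inf (q ^ a) (q ^ b)" if q: "q \<in> cball 0 r" for q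
  proof (rule LIMSEQ_unique)
    show "(\<lambda>N. \<Prod>j<N. 1 - q ^ a * (q ^ b) ^ j) \<longlonglongrightarrow> l q"
      using l q by (rule tendsto_uniform_limitI)
    have "norm (q ^ b) < 1" using q r assms by (intro norm_power_less_one) auto
    thus "(\<lambda>N. \<Prod>j<N. 1 - q ^ a * (q ^ b) ^ j) \<longlonglongrightarrow> qpoch_inf (q ^ a) (q ^ b)"
      using qpoch_tendsto[of "q ^ b" "q ^ a"] by (simp add: qpoch_def [abs_def])
  qed
  thus "uniform_limit (cball 0 r) (\<lambda>N q::complex. \<Prod>j<N. 1 - q ^ a * (q ^ b) ^ j) (\<lambda>q. qpoch_inf (q ^ a) (q ^ b)) sequentially"
    using l uniform_limit_cong'[of "cball 0 r" _ "\<lambda>N q. \<Prod>j<N. 1 - q ^ a * (q ^ b) ^ j" l "\<lambda>q. qpoch_inf (q ^ a) (q ^ b)"]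
    by auto
qed

section \<open>The generating function\<close>

text \<open>
  The denominators \<open>1 - q\<close>, \<open>1 - q\<^sup>2\<close> and \<open>(q;q\<^sup>2)\<^sub>\<infinity>\<close> have value 1 at 0 and no zero in the disc.
\<close>

lemma closed_form_integer_taylor:
  "integer_taylor (\<lambda>q. q * (1 - q ^ 3) / ((1 - q) * (1 - q ^ 2))
        * (qpoch_inf (q ^ 2) (q ^ 2) ^ 2 / qpoch_inf q (q ^ 2) ^ 2)
      - q * (1 + q ^ 2) / (1 - q) ^ 2)"
proof -
  have pow: "integer_taylor (\<lambda>q. q ^ i)" for i
    by (intro integer_taylor_power integer_taylor_ident)
  have fac: "integer_taylor (\<lambda>q. 1 - q ^ i)" for i
    by (intro integer_taylor_diff integer_taylor_1 pow)
  have inv: "integer_taylor (\<lambda>q. inverse (1 - q ^ i))" if "0 < i" for i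
  proof (rule integer_taylor_inverse[OF fac])
    show "1 - q ^ i \<noteq> 0" if "norm q < 1" for q :: complex
      using norm_power_less_one[OF that \<open>0 < i\<close>] by auto
  qed (use that in simp)
  have "integer_taylor (\<lambda>q. inverse (qpoch_inf (q ^ 1) (q ^ 2)))"
  proof (rule integer_taylor_inverse[OF qpoch_inf_integer_taylor])
    show "qpoch_inf (q ^ 1) (q ^ 2) \<noteq> 0" if "norm q < 1" for q
      using that by (intro qpoch_inf_nonzero mult_power_neq_one norm_power_less_one) auto
  qed (simp_all add: qpoch_inf_def)
  hence "integer_taylor (\<lambda>q. q ^ 1 * (1 - q ^ 3) * (inverse (1 - q ^ 1) * inverse (1 - q ^ 2))
        * (qpoch_inf (q ^ 2) (q ^ 2) ^ 2 * inverse (qpoch_inf (q ^ 1) (q ^ 2)) ^ 2)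
      - q ^ 1 * (1 + q ^ 2) * inverse (1 - q ^ 1) ^ 2)"
    by (intro integer_taylor_diff integer_taylor_mult integer_taylor_add integer_taylor_1
        integer_taylor_power[of "\<lambda>q. inverse (1 - q ^ 1)"]
        integer_taylor_power[of "\<lambda>q. inverse (qpoch_inf (q ^ 1) (q ^ 2))"]
        integer_taylor_power[of "\<lambda>q. qpoch_inf (q ^ 2) (q ^ 2)"]
        qpoch_inf_integer_taylor pow fac inv) auto
  thus ?thesis
    by (simp add: divide_inverse power_inverse)
qed

theorem theorem2p5:
  fixes q :: complex
  assumes "norm q < 1"
  shows "F2_term q summable_on UNIV \<and>
    (\<lambda>N. of_int (F2 N) * q ^ N) sums (\<Sum>\<^sub>\<infinity>p\<in>UNIV. F2_term q p) \<and>
    (\<Sum>N. of_int (F2 N) * q ^ N) =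
      q * (1 - q ^ 3) / ((1 - q) * (1 - q ^ 2))
        * (qpoch_inf (q ^ 2) (q ^ 2) ^ 2 / qpoch_inf q (q ^ 2) ^ 2)
      - q * (1 + q ^ 2) / (1 - q) ^ 2"
proof -
  define g where "g q = q * (1 - q ^ 3) / ((1 - q) * (1 - q ^ 2))
        * (qpoch_inf (q ^ 2) (q ^ 2) ^ 2 / qpoch_inf q (q ^ 2) ^ 2)
      - q * (1 + q ^ 2) / (1 - q) ^ 2" for q
  have sum_g: "(\<Sum>\<^sub>\<infinity>p. F2_term q p) = g q" if "norm q < 1" for q
    unfolding g_def by (rule F2_double_sum_eval[OF that])
  have "\<exists>!F :: nat \<Rightarrow> int. \<forall>q. norm q < 1 \<longrightarrow> (\<lambda>N. of_int (F N) * q ^ N) sums g q"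
    unfolding g_def by (rule integer_taylor_unique_coeffs[OF closed_form_integer_taylor])
  \<comment> \<open>Existence and uniqueness together are what the definite description in the definition of \<open>F2\<close> demands.\<close>
  hence "\<exists>!F :: nat \<Rightarrow> int. \<forall>q. norm q < 1 \<longrightarrow> (\<lambda>N. of_int (F N) * q ^ N) sums (\<Sum>\<^sub>\<infinity>p. F2_term q p)"
    by (simp add: sum_g cong: imp_cong)
  from theI'[OF this] have "(\<lambda>N. of_int (F2 N) * q ^ N) sums (\<Sum>\<^sub>\<infinity>p. F2_term q p)"
    using assms unfolding F2_def by blast
  moreover from this have "(\<Sum>N. of_int (F2 N) * q ^ N) = g q"
    using sums_unique sum_g[OF assms] by metis
  ultimately show ?thesis
    using F2_term_summable[OF assms] by (simp add: g_def)
qed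

end
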